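(* Fix a tree partition of $\omega$ with associated ideal $\mathcal H_{<\omega}=\bigcup_n\mathcal H_n$. Let $\varphi,\eta:\omega\to\omega$ be such that $x\mapsto(\varphi(x),\eta(x))$ witnesses $\mathrm{Fin}^{\otimes2}\le_K\mathcal H_{<\omega}$, and suppose the essential depth $\delta(\eta)$ is finite. Then $\delta(\varphi)\le\delta(\eta)$.
   Context: A tree partition of $\omega$ is a family $\langle A_s:s\in\omega^{<\omega}\rangle$ of infinite subsets of $\omega$ such that $A_\varnothing=\omega$, for each $s$ the family $\{A_{s^\frown n}:n\in\omega\}$ is a partition of $A_s$, and any two distinct points of $\omega$ lie in different cells $A_s\neq A_t$ with $|s|=|t|=n$ for some $n$. For $X\subseteq\omega$ let $T^\infty_X=\{s\in\omega^{<\omega}:X\cap A_s\text{ is infinite}\}$. For $T\subseteq\omega^{<\omega}$ put $\mathrm{Succ}_T(s)=\{n:s^\frown n\in T\}$ and $D(T)=\{s\in T:\mathrm{Succ}_T(s)\text{ is infinite}\}$; $D^0(T)=T$, $D^{n+1}(T)=D(D^n(T))$. For $n<\omega$, $\mathcal H_n=\{X\subseteq\omega:\varnothing\notin D^n(T^\infty_X)\}$ (an ideal on $\omega$). $\mathrm{Fin}^{\otimes2}$ is the ideal on $\omega^2$ of all $C$ such that $\{b:(a,b)\in C\}$ is finite for all but finitely many $a$. The map $(\varphi,\eta)$ witnesses $\mathrm{Fin}^{\otimes2}\le_K\mathcal H_{<\omega}$ if $\{x:(\varphi(x),\eta(x))\in C\}\in\mathcal H_{<\omega}$ for every $C\in\mathrm{Fin}^{\otimes2}$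 (so $\varphi$ is the outer coordinate). Essential depth: for $\psi:\omega\to\omega$, $\delta(\psi)$ is the least $d\ge1$ such that there is $Z\in\mathcal H_{<\omega}$ with $\psi[A_s\setminus Z]$ finite for every $s\in\omega^d$; $\delta(\psi)=\infty$ if there is no such $d$. *)

theory Defs
  imports Main "HOL-Library.Disjoint_Sets" "HOL-Library.Extended_Nat"
begin

text \<open>Elements of \<open>\<omega>\<^sup><\<^sup>\<omega>\<close> are finite lists of naturals; the one-point extension of \<open>s\<close> by \<open>n\<close>
  is \<open>s @ [n]\<close>, and \<open>|s|\<close> is \<open>length s\<close>.\<close>

definition tree_partition :: "(nat list \<Rightarrow> nat set) \<Rightarrow> bool" where
  "tree_partition A \<longleftrightarrow>
     (\<forall>s. infinite (A s)) \<and>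
     A [] = UNIV \<and>
     (\<forall>s. disjoint_family (\<lambda>n. A (s @ [n])) \<and> (\<Union>n. A (s @ [n])) = A s) \<and>
     (\<forall>x y. x \<noteq> y \<longrightarrow>
        (\<exists>s t. length s = length t \<and> A s \<noteq> A t \<and> x \<in> A s \<and> y \<in> A t))"

definition T_inf :: "(nat list \<Rightarrow> nat set) \<Rightarrow> nat set \<Rightarrow> nat list set" where
  "T_inf A X = {s. infinite (X \<inter> A s)}"

definition Succ_set :: "nat list set \<Rightarrow> nat list \<Rightarrow> nat set" where
  "Succ_set T s = {n. s @ [n] \<in> T}"

definition tree_deriv :: "nat list set \<Rightarrow> nat list set" where
  "tree_deriv T = {s \<in> T. infinite (Succ_set T s)}"

definition H_ideal :: "(nat list \<Rightarrow> nat set) \<Rightarrow> nat \<Rightarrow> nat set set" where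
  "H_ideal A n = {X. [] \<notin> (tree_deriv ^^ n) (T_inf A X)}"

definition H_fin :: "(nat list \<Rightarrow> nat set) \<Rightarrow> nat set set" where
  "H_fin A = (\<Union>n. H_ideal A n)"

definition Fin2 :: "(nat \<times> nat) set set" where
  "Fin2 = {C. finite {a. infinite {b. (a, b) \<in> C}}}"

definition katetov_witness :: "('b \<Rightarrow> 'a) \<Rightarrow> 'a set set \<Rightarrow> 'b set set \<Rightarrow> bool" where
  "katetov_witness f I J \<longleftrightarrow> (\<forall>C \<in> I. {x. f x \<in> C} \<in> J)"

definition depth_bound :: "(nat list \<Rightarrow> nat set) \<Rightarrow> (nat \<Rightarrow> nat) \<Rightarrow> nat \<Rightarrow> bool" where
  "depth_bound A \<psi> d \<longleftrightarrow> 1 \<le> d \<and>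
     (\<exists>Z \<in> H_fin A. \<forall>s. length s = d \<longrightarrow> finite (\<psi> ` (A s - Z)))"

definition ess_depth :: "(nat list \<Rightarrow> nat set) \<Rightarrow> (nat \<Rightarrow> nat) \<Rightarrow> enat" where
  "ess_depth A \<psi> =
     (if \<exists>d. depth_bound A \<psi> d then enat (LEAST d. depth_bound A \<psi> d) else \<infinity>)"

end

theory Submission
  imports Defs "HOL-Library.Countable"
begin

text \<open>Every \<open>d\<close> that bounds the depth of \<open>\<eta>\<close> also bounds the depth of \<open>\<phi>\<close>. Let \<open>Z\<close> be an exceptional
  set for \<open>\<eta>\<close> at level \<open>d\<close>, so that \<open>\<eta> \<le> g s\<close> on \<open>A s - Z\<close> for each \<open>s\<close> of length \<open>d\<close>. There are only
  countably many such \<open>s\<close>, so a single \<open>f\<close> eventually dominates all the constants \<open>g s\<close>: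
  \<open>g s \<le> f a\<close> once \<open>a\<close> is at least the index of \<open>s\<close>. The region below the graph of \<open>f\<close> is in
  \<open>Fin\<^sup>\<otimes>\<^sup>2\<close>, hence its preimage \<open>Y = {x. \<eta> x \<le> f (\<phi> x)}\<close> is in the ideal. A point of \<open>A s - Z\<close> at which
  \<open>\<phi>\<close> is at least the index of \<open>s\<close> lies in \<open>Y\<close>, so on \<open>A s - (Z \<union> Y)\<close> the map \<open>\<phi>\<close> stays below the
  index of \<open>s\<close>. Thus \<open>Z \<union> Y\<close> is an exceptional set for \<open>\<phi>\<close> at the same level \<open>d\<close>.

  It remains to see that \<open>\<H>\<^bsub><\<omega>\<^esub>\<close> is closed under finite unions. This is a pigeonhole argument at each
  node: if infinitely many successors lie in a union of two sets of nodes, then infinitely many lie in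
  one of them.\<close>

text \<open>The pigeonhole principle puts infinitely many successors of \<open>s\<close> into \<open>S\<close>, say, but
  membership in \<open>tree_deriv S\<close> also asks for \<open>s \<in> S\<close>. Derivatives need not be closed under
  initial segments; the weaker closure property below supplies \<open>s \<in> S\<close> and does survive
  derivation.\<close>

definition inf_succ_closed :: "nat list set \<Rightarrow> bool" where
  "inf_succ_closed T \<longleftrightarrow> (\<forall>s. infinite (Succ_set T s) \<longrightarrow> s \<in> T)"

lemma tree_deriv_subset: "tree_deriv T \<subseteq> T"
  by (auto simp: tree_deriv_def)

lemma Succ_set_mono: "S \<subseteq> T \<Longrightarrow> Succ_set S s \<subseteq> Succ_set T s"
  by (auto simp: Succ_set_def)

lemma inf_succ_closed_tree_deriv:
  assumes "inf_succ_closed T"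
  shows "inf_succ_closed (tree_deriv T)"
  unfolding inf_succ_closed_def
proof (intro allI impI)
  fix s assume "infinite (Succ_set (tree_deriv T) s)"
  then have "infinite (Succ_set T s)"
    using Succ_set_mono[OF tree_deriv_subset] finite_subset by blast
  with assms show "s \<in> tree_deriv T"
    by (simp add: inf_succ_closed_def tree_deriv_def)
qed

lemma inf_succ_closed_funpow:
  "inf_succ_closed T \<Longrightarrow> inf_succ_closed ((tree_deriv ^^ n) T)"
  by (induction n) (auto intro: inf_succ_closed_tree_deriv)

lemma tree_deriv_Un_subset:
  assumes "inf_succ_closed S" "inf_succ_closed T" "R \<subseteq> S \<union> T"
  shows "tree_deriv R \<subseteq> tree_deriv S \<union> tree_deriv T"
proof
  fix s assume "s \<in> tree_deriv R"
  then have "infinite (Succ_set R s)"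
    by (simp add: tree_deriv_def)
  moreover have "Succ_set R s \<subseteq> Succ_set S s \<union> Succ_set T s"
    using assms(3) by (auto simp: Succ_set_def)
  ultimately have "infinite (Succ_set S s) \<or> infinite (Succ_set T s)"
    using finite_subset by blast
  with assms(1,2) show "s \<in> tree_deriv S \<union> tree_deriv T"
    by (auto simp: inf_succ_closed_def tree_deriv_def)
qed

lemma funpow_tree_deriv_Un_subset:
  assumes "inf_succ_closed S" "inf_succ_closed T"
  shows "(tree_deriv ^^ n) (S \<union> T) \<subseteq> (tree_deriv ^^ n) S \<union> (tree_deriv ^^ n) T"
  using assms
  by (induction n) (simp_all add: tree_deriv_Un_subset inf_succ_closed_funpow)

lemma T_inf_Un: "T_inf A (X \<union> Y) = T_inf A X \<union> T_inf A Y"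
  by (auto simp: T_inf_def Int_Un_distrib2)

lemma tree_partition_child_subset: "tree_partition A \<Longrightarrow> A (s @ [n]) \<subseteq> A s"
  unfolding tree_partition_def by blast

lemma inf_succ_closed_T_inf:
  assumes "tree_partition A"
  shows "inf_succ_closed (T_inf A X)"
  unfolding inf_succ_closed_def
proof (intro allI impI)
  fix s assume "infinite (Succ_set (T_inf A X) s)"
  then obtain n where "infinite (X \<inter> A (s @ [n]))"
    using infinite_imp_nonempty by (fastforce simp: Succ_set_def T_inf_def)
  moreover have "X \<inter> A (s @ [n]) \<subseteq> X \<inter> A s"
    using tree_partition_child_subset[OF assms] by blast
  ultimately have "infinite (X \<inter> A s)"
    using finite_subset by blast
  then show "s \<in> T_inf A X"
    by (simp add: T_inf_def)
qed

lemma H_ideal_mono: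
  assumes "m \<le> n"
  shows "H_ideal A m \<subseteq> H_ideal A n"
  using assms
proof (induction rule: dec_induct)
  case (step k)
  then show ?case
    using tree_deriv_subset by (auto simp: H_ideal_def)
qed simp

lemma H_ideal_Un:
  assumes "tree_partition A" "X \<in> H_ideal A n" "Y \<in> H_ideal A n"
  shows "X \<union> Y \<in> H_ideal A n"
  using assms(2,3)
    funpow_tree_deriv_Un_subset[OF inf_succ_closed_T_inf inf_succ_closed_T_inf, OF assms(1,1)]
  by (fastforce simp: H_ideal_def T_inf_Un)

lemma H_fin_Un:
  assumes "tree_partition A" "X \<in> H_fin A" "Y \<in> H_fin A"
  shows "X \<union> Y \<in> H_fin A"
proof -
  obtain m n where "X \<in> H_ideal A m" "Y \<in> H_ideal A n"
    using assms(2,3) by (auto simp: H_fin_def)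
  then have "X \<in> H_ideal A (max m n)" "Y \<in> H_ideal A (max m n)"
    using H_ideal_mono[of m "max m n" A] H_ideal_mono[of n "max m n" A] by auto
  then show ?thesis
    using H_ideal_Un[OF assms(1)] by (auto simp: H_fin_def)
qed

lemma subgraph_in_Fin2: "{(a, b). b \<le> f a} \<in> Fin2"
  by (simp add: Fin2_def)

lemma depth_bound_outer_coordinate:
  assumes A: "tree_partition A"
    and wit: "katetov_witness (\<lambda>x. (\<phi> x, \<eta> x)) Fin2 (H_fin A)"
    and bound: "depth_bound A \<eta> d"
  shows "depth_bound A \<phi> d"
proof -
  obtain Z where d: "1 \<le> d" and Z: "Z \<in> H_fin A"
    and fin: "\<And>s. length s = d \<Longrightarrow> finite (\<eta> ` (A s - Z))"
    using bound by (auto simp: depth_bound_def)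
  define g where "g s = Max (\<eta> ` (A s - Z))" for s
  \<comment> \<open>The sum is just a convenient upper bound for the constants of all nodes of index at most \<open>a\<close>.\<close>
  define f where "f a = (\<Sum>i\<le>a. g (from_nat i))" for a
  have g_le_f: "g s \<le> f a" if "to_nat s \<le> a" for s a
    using member_le_sum[of "to_nat s" "{..a}" "\<lambda>i. g (from_nat i)"] that
    by (simp add: f_def)
  define Y where "Y = {x. \<eta> x \<le> f (\<phi> x)}"
  have "Y \<in> H_fin A"
    using wit subgraph_in_Fin2[of f] by (fastforce simp: katetov_witness_def Y_def)
  then have "Z \<union> Y \<in> H_fin A"
    using H_fin_Un[OF A Z] by blast
  moreover have "finite (\<phi> ` (A s - (Z \<union> Y)))" if s: "length s = d" for s
  proof -
    have "\<phi> x < to_nat s" if x: "x \<in> A s - (Z \<union> Y)" for x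
    proof (rule ccontr)
      assume "\<not> \<phi> x < to_nat s"
      then have "g s \<le> f (\<phi> x)"
        by (simp add: g_le_f)
      moreover have "\<eta> x \<le> g s"
        using fin[OF s] x by (auto simp: g_def)
      ultimately show False
        using x by (simp add: Y_def)
    qed
    then have "\<phi> ` (A s - (Z \<union> Y)) \<subseteq> {..<to_nat s}"
      by auto
    then show ?thesis
      using finite_subset by blast
  qed
  ultimately show ?thesis
    using d unfolding depth_bound_def by blast
qed

theorem theorem4p14:
  fixes A :: "nat list \<Rightarrow> nat set" and \<phi> \<eta> :: "nat \<Rightarrow> nat"
  assumes "tree_partition A"
    and "katetov_witness (\<lambda>x. (\<phi> x, \<eta> x)) Fin2 (H_fin A)"
    and "ess_depth A \<eta> < \<infinity>"
  shows "ess_depth A \<phi> \<le> ess_depth A \<eta>"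
proof -
  have ex: "\<exists>d. depth_bound A \<eta> d"
    using assms(3) by (auto simp: ess_depth_def split: if_splits)
  then have "depth_bound A \<phi> (LEAST d. depth_bound A \<eta> d)"
    using depth_bound_outer_coordinate[OF assms(1,2)] LeastI_ex by blast
  with ex show ?thesis
    by (auto simp: ess_depth_def intro: Least_le)
qed

end
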